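(* Let $A$ be a pseudo $BL$-algebra and $F$ an interval valued fuzzy set of $A$. Then $F$ is an interval valued $(\in,\in\!\vee q)$-fuzzy filter of $A$ if and only if for every interval number $\widehat t$ with $[0,0]<\widehat t\le[0.5,0.5]$, the level subset $F_{\widehat t}=\{x\in A\mid\widehat{\mu_F}(x)\ge\widehat t\}$, whenever nonempty, is a filter of $A$.
   Context: A pseudo $BL$-algebra is an algebra $(A;\wedge,\vee,\odot,\rightarrow,\hookrightarrow,0,1)$ of type $(2,2,2,2,2,0,0)$ such that $(A,\wedge,\vee,0,1)$ is a bounded lattice with lattice order $\le$, $(A,\odot,1)$ is a monoid, and for all $x,y,z\in A$: (a1) $x\odot y\le z\iff x\le y\rightarrow z\iff y\le x\hookrightarrow z$; (a2) $x\wedge y=(x\rightarrow y)\odot x=x\odot(x\hookrightarrow y)$; (a3) $(x\rightarrow y)\vee(y\rightarrow x)=(x\hookrightarrow y)\vee(y\hookrightarrow x)=1$. A filter of $A$ is a nonempty $I\subseteq A$ with $x\odot y\in I$ for $x,y\in I$, and $x\in I$, $x\le y$ imply $y\in I$. An interval number is $\widehat{a}=[a^{\bot},a^{\top}]$ with $0\le a^{\bot}\le a^{\top}\le 1$; $D[0,1]$ is the set of interval numbers. $\widehat{a}\le\widehat{b}$ iff $a^{\bot}\le b^{\bot}$ and $a^{\top}\le b^{\top}$; $\widehat{a}<\widehat{b}$ iff $\widehat{a}\le\widehat{b}$ and $\widehat{a}\ne\widehat{b}$; $\mathrm{rmin},\mathrm{rmax}$ and sums are componentwise. An interval valued fuzzy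 set $F$ of $A$ is a map $\widehat{\mu_F}:A\to D[0,1]$; standing assumption: for every $x\in A$, either $\widehat{\mu_F}(x)<[0.5,0.5]$ or $[0.5,0.5]\le\widehat{\mu_F}(x)$. For $x\in A$ and nonzero $\widehat t\in D[0,1]$: $U(x;\widehat t)\in F$ means $\widehat{\mu_F}(x)\ge\widehat t$; $U(x;\widehat t)\,q\,F$ means $\widehat{\mu_F}(x)+\widehat t>[1,1]$; $U(x;\widehat t)\in\!\vee q\,F$ means one of these holds. $F$ is an interval valued $(\in,\in\!\vee q)$-fuzzy filter if for all nonzero $\widehat t,\widehat r\in D[0,1]$ and $x,y\in A$: (F3) $U(x;\widehat t)\in F$ and $U(y;\widehat r)\in F$ imply $U(x\odot y;\mathrm{rmin}\{\widehat t,\widehat r\})\in\!\vee q\,F$; (F4) if $x\le y$ and $U(x;\widehat r)\in F$ then $U(y;\widehat r)\in\!\vee q\,F$.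
   Formalization: In (F3) and (F4), the values t and r range only over nonzero interval numbers comparable with [0.5,0.5]; with all nonzero interval numbers the "if" direction fails (two-element algebra, values [.5,.6] at 0 and [.5,.5] at 1, r=[.2,.6]). *)

theory Defs
  imports Complex_Main "HOL-Library.Product_Order"
begin

text \<open>
  The lattice order, meet, join, 0 and 1 are those of the class \<open>bounded_lattice\<close>:
  \<open>\<le>\<close>, \<open>inf\<close>, \<open>sup\<close>, \<open>bot\<close> and \<open>top\<close>. The product is not assumed commutative, so the
  two residuals differ in general; the degenerate algebra with \<open>bot = top\<close> is allowed.
\<close>

class pseudo_BL_algebra = bounded_lattice +
  fixes odot :: "'a \<Rightarrow> 'a \<Rightarrow> 'a"  (infixl "\<odot>" 70)
    and limp :: "'a \<Rightarrow> 'a \<Rightarrow> 'a"  (infixr "\<rightarrow>" 60)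
    and rimp :: "'a \<Rightarrow> 'a \<Rightarrow> 'a"  (infixr "\<hookrightarrow>" 60)
  assumes odot_assoc: "(x \<odot> y) \<odot> z = x \<odot> (y \<odot> z)"
    and top_odot: "top \<odot> x = x"
    and odot_top: "x \<odot> top = x"
    and residual_left: "x \<odot> y \<le> z \<longleftrightarrow> x \<le> y \<rightarrow> z"
    and residual_right: "x \<odot> y \<le> z \<longleftrightarrow> y \<le> x \<hookrightarrow> z"
    and divisible_left: "inf x y = (x \<rightarrow> y) \<odot> x"
    and divisible_right: "inf x y = x \<odot> (x \<hookrightarrow> y)"
    and prelinear_left: "sup (x \<rightarrow> y) (y \<rightarrow> x) = top"
    and prelinear_right: "sup (x \<hookrightarrow> y) (y \<hookrightarrow> x) = top"

definition pbl_filter :: "'a::pseudo_BL_algebra set \<Rightarrow> bool" where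
  "pbl_filter I \<longleftrightarrow> I \<noteq> {} \<and> (\<forall>x\<in>I. \<forall>y\<in>I. x \<odot> y \<in> I) \<and> (\<forall>x\<in>I. \<forall>y. x \<le> y \<longrightarrow> y \<in> I)"

text \<open>
  An interval number is the pair of its end points. Order, strict order and addition of
  pairs are the componentwise ones of \<open>Product_Order\<close> and \<open>Product_Plus\<close>; in particular
  \<open>a < b\<close> means \<open>a \<le> b\<close> and \<open>a \<noteq> b\<close>, and \<open>0\<close> is \<open>(0, 0)\<close>. The order is
  partial, and a sum of interval numbers may lie outside \<open>interval_numbers\<close>.
\<close>

definition interval_numbers :: "(real \<times> real) set" where
  "interval_numbers = {a. 0 \<le> fst a \<and> fst a \<le> snd a \<and> snd a \<le> 1}"

definition rmin :: "real \<times> real \<Rightarrow> real \<times> real \<Rightarrow> real \<times> real" where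
  "rmin a b = (min (fst a) (fst b), min (snd a) (snd b))"

text \<open>Interval valued fuzzy sets, including the standing comparability assumption.\<close>

definition iv_fuzzy_set :: "('a \<Rightarrow> real \<times> real) \<Rightarrow> bool" where
  "iv_fuzzy_set \<mu> \<longleftrightarrow>
     (\<forall>x. \<mu> x \<in> interval_numbers \<and> (\<mu> x < (1/2, 1/2) \<or> (1/2, 1/2) \<le> \<mu> x))"

text \<open>
  \<open>U(x; t)\<close> is the interval valued fuzzy set with support \<open>x\<close> and value \<open>t\<close>. Being an
  interval valued fuzzy set, it is subject to the standing assumption as well, so its value
  \<open>t\<close> is comparable with \<open>(1/2, 1/2)\<close>. This cannot be dropped: if \<open>t\<close> ranges over
  all nonzero interval numbers, the membership function on the two-element Boolean algebra
  with values \<open>(1/2, 3/5)\<close> at \<open>0\<close> and \<open>(1/2, 1/2)\<close> at \<open>1\<close> has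
  only filters as level subsets for levels below \<open>(1/2, 1/2)\<close>, but the value
  \<open>(1/5, 3/5)\<close> violates monotonicity.
\<close>

definition fuzzy_point :: "'a \<Rightarrow> real \<times> real \<Rightarrow> 'a \<Rightarrow> real \<times> real" where
  "fuzzy_point x t = (\<lambda>y. if y = x then t else 0)"

definition fuzzy_interval_value :: "'a \<Rightarrow> real \<times> real \<Rightarrow> bool" where
  "fuzzy_interval_value x t \<longleftrightarrow> t \<noteq> 0 \<and> iv_fuzzy_set (fuzzy_point x t)"

definition belongs :: "'a \<Rightarrow> real \<times> real \<Rightarrow> ('a \<Rightarrow> real \<times> real) \<Rightarrow> bool" where
  "belongs x t \<mu> \<longleftrightarrow> t \<le> \<mu> x"

definition quasi_coincident :: "'a \<Rightarrow> real \<times> real \<Rightarrow> ('a \<Rightarrow> real \<times> real) \<Rightarrow> bool" where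
  "quasi_coincident x t \<mu> \<longleftrightarrow> (1, 1) < \<mu> x + t"

definition belongs_or_q :: "'a \<Rightarrow> real \<times> real \<Rightarrow> ('a \<Rightarrow> real \<times> real) \<Rightarrow> bool" where
  "belongs_or_q x t \<mu> \<longleftrightarrow> belongs x t \<mu> \<or> quasi_coincident x t \<mu>"

definition in_or_q_fuzzy_filter :: "('a::pseudo_BL_algebra \<Rightarrow> real \<times> real) \<Rightarrow> bool" where
  "in_or_q_fuzzy_filter \<mu> \<longleftrightarrow>
     (\<forall>x y t r. fuzzy_interval_value x t \<longrightarrow> fuzzy_interval_value y r \<longrightarrow>
        belongs x t \<mu> \<longrightarrow> belongs y r \<mu> \<longrightarrow> belongs_or_q (x \<odot> y) (rmin t r) \<mu>) \<and>
     (\<forall>x y r. fuzzy_interval_value x r \<longrightarrow>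
        x \<le> y \<longrightarrow> belongs x r \<mu> \<longrightarrow> belongs_or_q y r \<mu>)"

definition level_subset :: "('a \<Rightarrow> real \<times> real) \<Rightarrow> real \<times> real \<Rightarrow> 'a set" where
  "level_subset \<mu> t = {x. t \<le> \<mu> x}"

end

theory Submission
  imports Defs
begin

text \<open>
  Below \<open>(1/2, 1/2)\<close> quasi-coincidence implies membership, so \<open>\<in>\<or>q\<close> is membership there and
  (F3), (F4) say that level subsets are filters. Above \<open>(1/2, 1/2)\<close> a point is
  \<open>\<in>\<or>q\<close>-related to \<open>\<mu>\<close> as soon as it lies in the level subset of \<open>(1/2, 1/2)\<close>.
\<close>

text \<open>Away from \<open>x\<close> the point takes the value \<open>0\<close>, which is an
  interval number below \<open>(1/2, 1/2)\<close>, so only the value \<open>t\<close> matters.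
  Strictness can be relaxed because \<open>t = (1/2, 1/2)\<close> falls under the second
  alternative.\<close>

lemma fuzzy_interval_value_iff:
  "fuzzy_interval_value x t \<longleftrightarrow>
     t \<noteq> 0 \<and> t \<in> interval_numbers \<and> (t \<le> (1/2, 1/2) \<or> (1/2, 1/2) \<le> t)"
  by (auto simp: fuzzy_interval_value_def iv_fuzzy_set_def fuzzy_point_def interval_numbers_def
      less_le zero_prod_def)

lemma interval_number_pos_iff:
  "t \<in> interval_numbers \<Longrightarrow> (0, 0) < t \<longleftrightarrow> t \<noteq> 0"
  by (cases t) (auto simp: less_le interval_numbers_def zero_prod_def)

text \<open>If \<open>\<mu> x + t\<close> exceeds \<open>(1, 1)\<close>, then
  \<open>\<mu> x \<ge> (1, 1) - t \<ge> (1/2, 1/2) \<ge> t\<close>.\<close>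

lemma belongs_or_q_le_half:
  assumes "t \<le> (1/2, 1/2)"
  shows "belongs_or_q x t \<mu> \<longleftrightarrow> t \<le> \<mu> x"
  using assms by (cases t; cases "\<mu> x")
    (auto simp: belongs_or_q_def belongs_def quasi_coincident_def less_le)

text \<open>The sum is at least \<open>(1, 1)\<close>, with equality only if both summands are
  \<open>(1/2, 1/2)\<close>; in that case \<open>t \<le> \<mu> x\<close>.\<close>

lemma belongs_or_q_ge_half:
  assumes "(1/2, 1/2) \<le> t" and "(1/2, 1/2) \<le> \<mu> x"
  shows "belongs_or_q x t \<mu>"
  using assms by (cases t; cases "\<mu> x")
    (auto simp: belongs_or_q_def belongs_def quasi_coincident_def less_le)

lemma rmin_le: "rmin a b \<le> a" "rmin a b \<le> b"
  by (simp_all add: rmin_def less_eq_prod_def)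

lemma rmin_greatest: "c \<le> a \<Longrightarrow> c \<le> b \<Longrightarrow> c \<le> rmin a b"
  by (simp add: rmin_def less_eq_prod_def)

lemma rmin_idem: "rmin a a = a"
  by (simp add: rmin_def)

text \<open>An interval number is nonzero exactly when its upper end is positive, and this survives
  the minimum. For comparability: if \<open>t\<close> or \<open>r\<close> is below
  \<open>(1/2, 1/2)\<close>, so is \<open>rmin t r\<close>; otherwise both are above it, and so is
  \<open>rmin t r\<close>.\<close>

lemma fuzzy_interval_value_rmin:
  assumes "fuzzy_interval_value x t" and "fuzzy_interval_value y r"
  shows "fuzzy_interval_value z (rmin t r)"
proof -
  have "rmin t r \<noteq> 0" "rmin t r \<in> interval_numbers"
    using assms unfolding fuzzy_interval_value_iff
    by (cases t; cases r; auto simp: rmin_def interval_numbers_def zero_prod_def min_def)+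
  moreover have "rmin t r \<le> (1/2, 1/2) \<or> (1/2, 1/2) \<le> rmin t r"
    using assms unfolding fuzzy_interval_value_iff
    by (meson order_trans rmin_le rmin_greatest)
  ultimately show ?thesis by (simp add: fuzzy_interval_value_iff)
qed

theorem theorem3p7:
  fixes \<mu> :: "'a::pseudo_BL_algebra \<Rightarrow> real \<times> real"
  assumes "iv_fuzzy_set \<mu>"
  shows "in_or_q_fuzzy_filter \<mu> \<longleftrightarrow>
    (\<forall>t\<in>interval_numbers. (0, 0) < t \<and> t \<le> (1/2, 1/2) \<and> level_subset \<mu> t \<noteq> {}
       \<longrightarrow> pbl_filter (level_subset \<mu> t))"
    (is "_ \<longleftrightarrow> ?levels")
proof
  assume F: "in_or_q_fuzzy_filter \<mu>"
  show ?levels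
  proof (intro ballI impI)
    fix t
    assume "t \<in> interval_numbers"
      and t: "(0, 0) < t \<and> t \<le> (1/2, 1/2) \<and> level_subset \<mu> t \<noteq> {}"
    then have v: "fuzzy_interval_value x t" for x :: 'a
      by (simp add: fuzzy_interval_value_iff interval_number_pos_iff)
    \<comment> \<open>(F3) is used with both levels equal to \<open>t\<close>.\<close>
    have "t \<le> \<mu> (x \<odot> y)" if "t \<le> \<mu> x" "t \<le> \<mu> y" for x y
      using F v[of x] v[of y] that t belongs_or_q_le_half[of t "x \<odot> y" \<mu>]
      unfolding in_or_q_fuzzy_filter_def belongs_def by (metis rmin_idem)
    moreover have "t \<le> \<mu> y" if "x \<le> y" "t \<le> \<mu> x" for x y
      using F v[of x] that t belongs_or_q_le_half[of t y \<mu>]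
      unfolding in_or_q_fuzzy_filter_def belongs_def by blast
    ultimately show "pbl_filter (level_subset \<mu> t)"
      using t by (auto simp: pbl_filter_def level_subset_def)
  qed
next
  assume L: ?levels
  have closed: "(t \<le> \<mu> x \<and> t \<le> \<mu> y \<longrightarrow> t \<le> \<mu> (x \<odot> y)) \<and> (t \<le> \<mu> x \<and> x \<le> y \<longrightarrow> t \<le> \<mu> y)"
    if "t \<in> interval_numbers" "t \<noteq> 0" "t \<le> (1/2, 1/2)" for t x y
    using L that unfolding pbl_filter_def level_subset_def
    by (auto simp: interval_number_pos_iff)
  have half: "(1/2, 1/2) \<in> interval_numbers" "(1/2, 1/2) \<noteq> (0 :: real \<times> real)"
    by (auto simp: interval_numbers_def zero_prod_def)
  have mult: "belongs_or_q (x \<odot> y) t \<mu>" if "fuzzy_interval_value x t" "t \<le> \<mu> x" "t \<le> \<mu> y" for t x y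
  proof (cases "t \<le> (1/2, 1/2)")
    case True
    then show ?thesis
      using that closed by (simp add: belongs_or_q_le_half fuzzy_interval_value_iff)
  next
    case False
    \<comment> \<open>The order is partial, so this rests on the comparability built into
      \<open>fuzzy_interval_value\<close>. The closure is then taken at the largest admissible level
      \<open>(1/2, 1/2)\<close>.\<close>
    then have "(1/2, 1/2) \<le> t"
      using that(1) by (simp add: fuzzy_interval_value_iff)
    then show ?thesis
      using that closed[OF half order_refl] by (meson belongs_or_q_ge_half order_trans)
  qed
  have mono: "belongs_or_q y t \<mu>" if "fuzzy_interval_value x t" "t \<le> \<mu> x" "x \<le> y" for t x y
  proof (cases "t \<le> (1/2, 1/2)")
    case True
    then show ?thesis
      using that closed belongs_or_q_le_half fuzzy_interval_value_iff by metis
  next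
    case False
    then have "(1/2, 1/2) \<le> t"
      using that(1) by (simp add: fuzzy_interval_value_iff)
    then show ?thesis
      using that closed[OF half order_refl] by (meson belongs_or_q_ge_half order_trans)
  qed
  \<comment> \<open>For (F3), \<open>rmin t r\<close> lies below both levels, so \<open>mult\<close>
    applies with it as the common level.\<close>
  show "in_or_q_fuzzy_filter \<mu>"
    unfolding in_or_q_fuzzy_filter_def belongs_def
    by (meson mult mono fuzzy_interval_value_rmin order_trans rmin_le)
qed

end
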